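(* A horizontal generating function of the $(q,r)$-Whitney-Lah numbers $L_{m,r}[n,k]_q$ is given by $$\sum_{k=0}^n L_{m,r}[n,k]_q\,[t|m]_{k,q}=[t+2r|m]_{\overline{n},q},$$ where $[t+2r|m]_{\overline{n},q}=\prod_{i=0}^{n-1}[t+2r+im]_q$ if $n\ge 1$, and $[t+2r|m]_{\overline{n},q}=1$ if $n=0$.
   Context: Here $q,m,r$ are parameters, and $[x]_q=\frac{q^x-1}{q-1}$, so that $[t-k]_q=\frac{1}{q^k}([t]_q-[k]_q)$. Also $[t|m]_{0,q}=1$ and $[t|m]_{k+1,q}=[t|m]_{k,q}[t-km]_q$, i.e. $[t|m]_{k,q}=\prod_{i=0}^{k-1}[t-im]_q$. The $(q,r)$-Whitney-Lah numbers are defined by $$L_{m,r}[n,k]_q=q^{2r+m(k-1)+m(n-1)}L_{m,r}[n-1,k-1]_q+[2r+km+(n-1)m]_q\,L_{m,r}[n-1,k]_q,$$ with $L_{m,r}[n,k]_q=0$ if $n<k$ or $n,k<0$, and $L_{m,r}[n,k]_q=1$ if $n=k$ and $n\ge 0$.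
   Formalization: The initial condition L[n,n]=1 for all n≥0 contradicts the recurrence (which gives L[1,1]=q^{2r}) and would make the identity false at n=1; here only L[0,0]=1 is prescribed, and the diagonal values for n≥1 come from the recurrence. *)

theory Defs
  imports Complex_Main "HOL-Analysis.Complex_Transcendental"
begin

text \<open>
  The parameters and the variable are complex, and powers of the base are taken with the
  principal branch; for a positive real base this is the usual real power on real exponents.
\<close>

definition q_bracket :: "complex \<Rightarrow> complex \<Rightarrow> complex" where
  "q_bracket q x = (q powr x - 1) / (q - 1)"

primrec q_falling :: "complex \<Rightarrow> complex \<Rightarrow> complex \<Rightarrow> nat \<Rightarrow> complex" where
  "q_falling q m t 0 = 1"
| "q_falling q m t (Suc k) = q_falling q m t k * q_bracket q (t - of_nat k * m)"

definition q_rising :: "complex \<Rightarrow> complex \<Rightarrow> complex \<Rightarrow> nat \<Rightarrow> complex" where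
  "q_rising q m x n = (\<Prod>i<n. q_bracket q (x + of_nat i * m))"

text \<open>
  The indices are integers, since the recurrence at \<open>k = 0\<close> refers to \<open>k - 1\<close>.
  The value 1 is prescribed at \<open>n = k = 0\<close> only. Prescribing it on the whole diagonal would
  contradict the recurrence, which gives the value \<open>q powr (2 * r)\<close> at \<open>n = k = 1\<close>; the
  diagonal values for \<open>n > 0\<close> are those given by the recurrence.
\<close>

function whitney_lah :: "complex \<Rightarrow> complex \<Rightarrow> complex \<Rightarrow> int \<Rightarrow> int \<Rightarrow> complex" where
  "whitney_lah q m r n k =
     (if n < k \<or> n < 0 \<or> k < 0 then 0
      else if n = 0 then 1
      else q powr (2 * r + m * (of_int k - 1) + m * (of_int n - 1)) * whitney_lah q m r (n - 1) (k - 1)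
         + q_bracket q (2 * r + of_int k * m + (of_int n - 1) * m) * whitney_lah q m r (n - 1) k)"
  by pat_completeness auto
termination
  by (relation "Wellfounded.measure (\<lambda>(q, m, r, n, k). nat (n + 1))") auto

declare whitney_lah.simps [simp del]

lemma whitney_lah_0_0: "whitney_lah q m r 0 0 = 1"
  by (simp add: whitney_lah.simps)

lemma whitney_lah_eq_0: "n < k \<or> n < 0 \<or> k < 0 \<Longrightarrow> whitney_lah q m r n k = 0"
  by (simp add: whitney_lah.simps)

text \<open>The recurrence holds for every positive \<open>n\<close> and every integer \<open>k\<close>.\<close>

lemma whitney_lah_rec:
  assumes "n > 0"
  shows "whitney_lah q m r n k =
     q powr (2 * r + m * (of_int k - 1) + m * (of_int n - 1)) * whitney_lah q m r (n - 1) (k - 1)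
     + q_bracket q (2 * r + of_int k * m + (of_int n - 1) * m) * whitney_lah q m r (n - 1) k"
proof (cases "n < k \<or> k < 0")
  case True
  then show ?thesis
    using assms by (auto simp: whitney_lah_eq_0)
next
  case False
  then show ?thesis
    using assms by (subst whitney_lah.simps) simp
qed

end

theory Submission
  imports Defs
begin

text \<open>This telescopes \<open>q powr (x + y) - 1\<close> through \<open>q powr y\<close>. The
  asymmetric form leaves the bracket of \<open>x\<close> as a factor, ready to extend a falling
  product.\<close>

lemma q_bracket_add: "q_bracket q (x + y) = q_bracket q y + q powr y * q_bracket q x"
  by (simp add: q_bracket_def powr_add add_divide_distrib [symmetric] algebra_simps)

text \<open>
  Splitting the argument as \<open>(t - k m) + (2 r + k m + n m)\<close> produces exactly the two weights
  of the recurrence, leading from \<open>(n, k)\<close> to \<open>(n + 1, k)\<close> and to \<open>(n + 1, k + 1)\<close>.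
\<close>

lemma q_falling_times_q_bracket:
  "q_falling q m t k * q_bracket q (t + 2 * r + of_nat n * m) =
     q_bracket q (2 * r + of_nat k * m + of_nat n * m) * q_falling q m t k
     + q powr (2 * r + m * of_nat k + m * of_nat n) * q_falling q m t (Suc k)"
proof -
  have split: "t + 2 * r + of_nat n * m = (t - of_nat k * m) + (2 * r + of_nat k * m + of_nat n * m)"
    by simp
  show ?thesis
    unfolding split q_bracket_add by (simp add: algebra_simps)
qed

theorem theorem3p1:
  fixes q m r t :: complex and n :: nat
  assumes "q \<noteq> 0" and "q \<noteq> 1"
  shows "(\<Sum>k = 0..n. whitney_lah q m r (int n) (int k) * q_falling q m t k)
           = q_rising q m (t + 2 * r) n"
proof (induction n)
  case 0
  show ?case
    by (simp add: whitney_lah_0_0 q_rising_def)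
next
  case (Suc n)
  define L where "L n k = whitney_lah q m r n k" for n k
  define F where "F = q_falling q m t"
  \<comment> \<open>Both weights are indexed by the column of row \<open>n\<close> that they start
    from: \<open>a k\<close> stays in column \<open>k\<close>, \<open>b k\<close> moves to
    \<open>k + 1\<close>. Hence \<open>b\<close> has \<open>k\<close> where the recurrence has
    \<open>k - 1\<close>.\<close>
  define a where "a k = q_bracket q (2 * r + of_nat k * m + of_nat n * m)" for k
  define b where "b k = q powr (2 * r + m * of_nat k + m * of_nat n)" for k
  \<comment> \<open>In column 0 the other term of the recurrence has column index -1 and
    vanishes.\<close>
  have rec_0: "L (int (Suc n)) (int 0) = a 0 * L (int n) (int 0)"
    using whitney_lah_rec [of "int (Suc n)" q m r 0]
    by (simp add: L_def a_def whitney_lah_eq_0)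
  have rec_Suc: "L (int (Suc n)) (int (Suc k)) =
      b k * L (int n) (int k) + a (Suc k) * L (int n) (int (Suc k))" for k
    using whitney_lah_rec [of "int (Suc n)" q m r "int (Suc k)"]
    by (simp add: L_def a_def b_def)
  have top: "L (int n) (int (Suc n)) = 0"
    by (simp add: L_def whitney_lah_eq_0)
  have "(\<Sum>k = 0..Suc n. L (int (Suc n)) (int k) * F k)
      = a 0 * L (int n) (int 0) * F 0
        + (\<Sum>k\<le>n. a (Suc k) * L (int n) (int (Suc k)) * F (Suc k))
        + (\<Sum>k\<le>n. b k * L (int n) (int k) * F (Suc k))"
    unfolding atLeast0AtMost sum.atMost_Suc_shift rec_0 rec_Suc
    by (simp only: distrib_right sum.distrib add_ac)
  \<comment> \<open>The split-off term is the missing \<open>k = 0\<close> term of the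
    \<open>a\<close>-sum.\<close>
  also have "\<dots> = (\<Sum>k\<le>Suc n. a k * L (int n) (int k) * F k)
        + (\<Sum>k\<le>n. b k * L (int n) (int k) * F (Suc k))"
    by (simp only: sum.atMost_Suc_shift)
  \<comment> \<open>By \<open>top\<close> the \<open>a\<close>-sum stops at \<open>n\<close>, so
    both sums can be grouped by entries of row \<open>n\<close>.\<close>
  also have "\<dots> = (\<Sum>k\<le>n. L (int n) (int k) * (a k * F k + b k * F (Suc k)))"
    by (simp only: sum.atMost_Suc top) (simp add: sum.distrib [symmetric] algebra_simps)
  \<comment> \<open>Each group contains the same new bracket, independent of \<open>k\<close>, which
    factors out.\<close>
  also have "\<dots> = (\<Sum>k\<le>n. L (int n) (int k) * F k) * q_bracket q (t + 2 * r + of_nat n * m)"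
    by (simp only: a_def b_def F_def q_falling_times_q_bracket [symmetric] sum_distrib_right mult.assoc)
  also have "\<dots> = q_rising q m (t + 2 * r) (Suc n)"
    using Suc.IH by (simp add: L_def F_def atLeast0AtMost q_rising_def)
  finally show ?case
    by (simp only: L_def F_def)
qed

end
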